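(* Let $S$ and $\Delta$ be numerical semigroups. Then $\Delta$ is an ideal extension of $S$ if and only if $S\subseteq\Delta\subseteq S\cup\mathrm{PF}(S)$.
   Context: A numerical semigroup is a subset $S\subseteq\mathbb{N}$ containing $0$, closed under addition, with finite complement in $\mathbb{N}$. An ideal of a numerical semigroup $\Delta$ is a nonempty $I\subseteq\Delta$ with $I+\Delta=\{a+b\mid a\in I,b\in\Delta\}\subseteq I$. $\Delta$ is an ideal extension of $S$ if $S\setminus\{0\}$ is an ideal of $\Delta$. $\mathrm{PF}(S)$ (pseudo-Frobenius numbers) is the set of integers $x\notin S$ such that $x+s\in S$ for all $s\in S\setminus\{0\}$. *)

theory Defs
  imports Main
begin

definition numerical_semigroup :: "nat set \<Rightarrow> bool" where
  "numerical_semigroup S \<longleftrightarrow>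
     0 \<in> S \<and> (\<forall>a\<in>S. \<forall>b\<in>S. a + b \<in> S) \<and> finite (UNIV - S)"

definition semigroup_ideal :: "nat set \<Rightarrow> nat set \<Rightarrow> bool" where
  "semigroup_ideal I \<Delta> \<longleftrightarrow>
     I \<noteq> {} \<and> I \<subseteq> \<Delta> \<and> {a + b | a b. a \<in> I \<and> b \<in> \<Delta>} \<subseteq> I"

definition ideal_extension :: "nat set \<Rightarrow> nat set \<Rightarrow> bool" where
  "ideal_extension \<Delta> S \<longleftrightarrow> semigroup_ideal (S - {0}) \<Delta>"

(* Pseudo-Frobenius numbers are integers and may be negative: PF UNIV = {-1}. *)
definition PF :: "nat set \<Rightarrow> int set" where
  "PF S = {x. x \<notin> int ` S \<and> (\<forall>s\<in>S - {0}. x + int s \<in> int ` S)}"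

end

theory Submission
  imports Defs
begin

text \<open>Write M for \<open>S - {0}\<close>. The ideal condition is in essence M + \<Delta>
  \<subseteq> M, and it can be tested one b in \<Delta> at a time. Since a sum with a positive term
  is positive, b + M \<subseteq> M amounts to b + M \<subseteq> S. This holds for every b in S by
  closure under addition, and for b outside S it is the definition of a pseudo-Frobenius number
  (\<open>int_in_PF_iff\<close>). So it says exactly that b lies in S or in
  \<open>PF S\<close>.\<close>

text \<open>Supplies the nonemptiness that an ideal requires; it comes from the finite complement of
  S.\<close>

lemma numerical_semigroup_nonzero:
  assumes "numerical_semigroup S"
  shows "S - {0} \<noteq> {}"
proof
  assume "S - {0} = {}"
  then have "UNIV - {0} \<subseteq> UNIV - S"
    by blast
  then have "finite (UNIV - {0 :: nat})"
    using assms unfolding numerical_semigroup_def by (metis finite_subset)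
  then show False
    by simp
qed

text \<open>As \<open>int\<close> is injective and additive, the integer condition can be checked
  within the naturals, where \<Delta> lives.\<close>

lemma int_in_PF_iff: "int x \<in> PF S \<longleftrightarrow> x \<notin> S \<and> (\<forall>s\<in>S - {0}. x + s \<in> S)"
proof -
  have "int n \<in> int ` S \<longleftrightarrow> n \<in> S" for n
    by auto
  then show ?thesis
    unfolding PF_def by (simp flip: of_nat_add)
qed

theorem theorem3:
  fixes S \<Delta> :: "nat set"
  assumes "numerical_semigroup S" and "numerical_semigroup \<Delta>"
  shows "ideal_extension \<Delta> S \<longleftrightarrow> S \<subseteq> \<Delta> \<and> int ` \<Delta> \<subseteq> int ` S \<union> PF S"
proof
  assume "ideal_extension \<Delta> S"
  then have ideal: "semigroup_ideal (S - {0}) \<Delta>"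
    by (simp add: ideal_extension_def)
  then have sub: "S - {0} \<subseteq> \<Delta>"
    by (simp add: semigroup_ideal_def)
  have absorb: "a + b \<in> S - {0}" if "a \<in> S - {0}" "b \<in> \<Delta>" for a b
    using ideal that unfolding semigroup_ideal_def by blast
  \<comment> \<open>The ideal covers only the nonzero elements; 0 lies in \<Delta> because \<Delta>
    is a semigroup.\<close>
  have "S \<subseteq> \<Delta>"
    using sub assms(2) unfolding numerical_semigroup_def by blast
  moreover have "int x \<in> int ` S \<union> PF S" if "x \<in> \<Delta>" for x
  proof -
    have "x + s \<in> S" if "s \<in> S - {0}" for s
      using absorb[OF that \<open>x \<in> \<Delta>\<close>] by (metis DiffD1 add.commute)
    then show ?thesis
      \<comment> \<open>Either x is in S, or the sums just shown to lie in S make it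
        pseudo-Frobenius.\<close>
      unfolding Un_iff int_in_PF_iff by blast
  qed
  ultimately show "S \<subseteq> \<Delta> \<and> int ` \<Delta> \<subseteq> int ` S \<union> PF S"
    by blast
next
  assume R: "S \<subseteq> \<Delta> \<and> int ` \<Delta> \<subseteq> int ` S \<union> PF S"
  have "a + b \<in> S - {0}" if a: "a \<in> S - {0}" and b: "b \<in> \<Delta>" for a b
  proof -
    have "b \<in> S \<or> int b \<in> PF S"
      using R b by auto
    then have "a + b \<in> S"
    proof
      assume "b \<in> S"
      then show ?thesis
        using assms(1) a unfolding numerical_semigroup_def by blast
    next
      assume "int b \<in> PF S"
      then show ?thesis
        using a unfolding int_in_PF_iff by (metis add.commute)
    qed
    \<comment> \<open>The sum is nonzero because a is positive.\<close>
    then show ?thesis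
      using a by simp
  qed
  then have "{a + b | a b. a \<in> S - {0} \<and> b \<in> \<Delta>} \<subseteq> S - {0}"
    by auto
  moreover have "S - {0} \<subseteq> \<Delta>"
    using R by auto
  ultimately show "ideal_extension \<Delta> S"
    using numerical_semigroup_nonzero[OF assms(1)]
    unfolding ideal_extension_def semigroup_ideal_def by simp
qed

end
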